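(* Let $G$ be a finite unicyclic graph whose unique cycle has length $n$ (an induced cycle $C_n$), where $n\geqslant 6$ and $\gcd(n,3)=3$. Then $D_3(G)$ is connected if and only if $G$ has two inner nodes whose distance is $3k+1$ or $3k+2$ for some integer $k\geqslant 0$.
   Context: A unicyclic graph is a connected graph containing exactly one cycle. The $3$-distance graph $D_3(G)$ has vertex set $V(G)$, two vertices being adjacent iff their distance in $G$ is exactly $3$. A vertex $u$ of $G$ is an inner node if $\deg(u)\geqslant 3$ and $u$ has at least two neighbours of degree at least $2$. *)

theory Defs
  imports "Graph_Theory.Graph_Theory"
begin

text \<open>
  Finite simple graphs are the \<open>pair_graph\<close>s of the Graph_Theory entry: finite, loop-free,
  symmetric arc relations. An undirected edge is represented by both of its arcs, so
  the degree of a vertex is its out-degree.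
\<close>

abbreviation degree :: "'a pair_pre_digraph \<Rightarrow> 'a \<Rightarrow> nat" where
  "degree G u \<equiv> out_degree (with_proj G) u"

text \<open>
  \<open>wf_digraph.\<mu>\<close> is the infimum of the walk costs; with unit arc costs this is the least number
  of edges of a walk, and \<open>\<infinity>\<close> if there is none.
\<close>

definition distance :: "'a pair_pre_digraph \<Rightarrow> 'a \<Rightarrow> 'a \<Rightarrow> ereal" where
  "distance G u v = wf_digraph.\<mu> (with_proj G) (\<lambda>_. 1) u v"

definition distance_graph :: "nat \<Rightarrow> 'a pair_pre_digraph \<Rightarrow> 'a pair_pre_digraph" where
  "distance_graph k G =
     \<lparr> pverts = pverts G,
       parcs = {(u, v). u \<in> pverts G \<and> v \<in> pverts G \<and> distance G u v = ereal (real k)} \<rparr>"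

text \<open>
  A cycle is identified with its set of undirected edges, so that the closed walks which differ only
  in starting point or orientation give the same cycle. The length condition is needed because
  \<open>pre_digraph.cycle\<close> also accepts the walk that traverses one edge back and forth.
\<close>

definition is_cycle :: "'a pair_pre_digraph \<Rightarrow> 'a set set \<Rightarrow> bool" where
  "is_cycle G C \<longleftrightarrow>
     (\<exists>p. pre_digraph.cycle (with_proj G) p \<and> length p \<ge> 3 \<and> C = (\<lambda>(u, v). {u, v}) ` set p)"

definition unicyclic :: "'a pair_pre_digraph \<Rightarrow> bool" where
  "unicyclic G \<longleftrightarrow> Digraph_Component.connected (with_proj G) \<and> (\<exists>!C. is_cycle G C)"

definition inner_node :: "'a pair_pre_digraph \<Rightarrow> 'a \<Rightarrow> bool" where
  "inner_node G u \<longleftrightarrow>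
     u \<in> pverts G \<and> degree G u \<ge> 3 \<and> card {v. (u, v) \<in> parcs G \<and> degree G v \<ge> 2} \<ge> 2"

end

theory Submission
  imports Defs "HOL-Number_Theory.Cong"
begin

text \<open>
  Around an inner node \<open>u\<close> the 3-distance graph has at most two components: the vertices whose
  distance to \<open>u\<close> is divisible by 3, and all others. Indeed, a vertex at distance at least 3 can be
  moved 3 steps towards \<open>u\<close>, and the vertices at distances 1 and 2 are linked through \<open>u\<close> since the
  girth is at least 6. A second inner node at a distance not divisible by 3 merges the two classes.

  Conversely, number the cycle vertices by their position, and give a vertex of a tree attached at
  position \<open>i\<close> and of depth \<open>t\<close> the phase \<open>i + t\<close> modulo 3, which is well defined as 3 divides \<open>n\<close>.
  Along an edge the phase changes by 1 or -1, and where the direction of change turns inside a path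
  of length 3, there is an inner node. If all distances between inner nodes are divisible by 3, then all
  inner nodes have the same phase \<open>c\<close>, and adjacency in the 3-distance graph preserves whether a
  vertex has phase \<open>c\<close>.
\<close>

section \<open>Distances and branching vertices\<close>

text \<open>Inner nodes in terms of arcs alone: the second neighbours \<open>a'\<close> and
  \<open>b'\<close> stand for degree at least 2 of \<open>a\<close> and \<open>b\<close>, so that no
  cardinality enters. \<open>inner_node_iff_branching\<close> gives the equivalence.\<close>

definition branching :: "'a rel \<Rightarrow> 'a \<Rightarrow> bool" where
  "branching E u \<longleftrightarrow> (\<exists>a b c a' b'. a \<noteq> b \<and> a \<noteq> c \<and> b \<noteq> c \<and>
     (u, a) \<in> E \<and> (u, b) \<in> E \<and> (u, c) \<in> E \<and>
     (a, a') \<in> E \<and> a' \<noteq> u \<and> (b, b') \<in> E \<and> b' \<noteq> u)"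

lemma branchingI:
  assumes "a \<noteq> b" "a \<noteq> c" "b \<noteq> c" "(u, a) \<in> E" "(u, b) \<in> E" "(u, c) \<in> E"
    and "(a, a') \<in> E" "a' \<noteq> u" "(b, b') \<in> E" "b' \<noteq> u"
  shows "branching E u"
  using assms unfolding branching_def by blast

lemma mod3_cases:
  fixes d :: nat
  assumes "\<not> 3 dvd d"
  shows "d mod 3 = 2 \<or> d = 1 \<or> d mod 3 = 1 \<and> 2 \<le> d"
  using assms by presburger

section \<open>Graph distance and the 3-distance relation\<close>

locale connected_graph =
  fixes V :: "'a set" and E :: "'a rel"
  assumes edges_in_verts: "E \<subseteq> V \<times> V"
    and sym_edges: "sym E"
    and irrefl_edges: "irrefl E"
    and connected_verts: "x \<in> V \<Longrightarrow> y \<in> V \<Longrightarrow> (x, y) \<in> E\<^sup>*"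
begin

definition gdist :: "'a \<Rightarrow> 'a \<Rightarrow> nat" where
  "gdist x y = (LEAST k. (x, y) \<in> E ^^ k)"

definition E3 :: "'a rel" where
  "E3 = {(x, y). x \<in> V \<and> y \<in> V \<and> gdist x y = 3}"

lemma edge_sym: "(x, y) \<in> E \<Longrightarrow> (y, x) \<in> E"
  using sym_edges by (rule symD)

lemma edge_neq: "(x, y) \<in> E \<Longrightarrow> x \<noteq> y"
  using irrefl_edges by (auto simp: irrefl_def)

lemma edge_verts: "(x, y) \<in> E \<Longrightarrow> x \<in> V" "(x, y) \<in> E \<Longrightarrow> y \<in> V"
  using edges_in_verts by auto

lemma gdist_relpow: "x \<in> V \<Longrightarrow> y \<in> V \<Longrightarrow> (x, y) \<in> E ^^ gdist x y"
  unfolding gdist_def using connected_verts rtrancl_imp_relpow LeastI_ex by metis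

lemma gdist_le: "(x, y) \<in> E ^^ k \<Longrightarrow> gdist x y \<le> k"
  unfolding gdist_def by (rule Least_le)

lemma relpow_edge_sym: "(x, y) \<in> E ^^ k \<Longrightarrow> (y, x) \<in> E ^^ k"
proof (induction k arbitrary: y)
  case (Suc k)
  then obtain z where "(x, z) \<in> E ^^ k" "(z, y) \<in> E" by auto
  then show ?case using Suc.IH edge_sym relpow_Suc_I2 by metis
qed simp

lemma gdist_sym: "gdist x y = gdist y x"
  unfolding gdist_def using relpow_edge_sym by metis

lemma gdist_self [simp]: "gdist x x = 0"
  using gdist_le[of x x 0] by simp

lemma gdist_0_iff: "x \<in> V \<Longrightarrow> y \<in> V \<Longrightarrow> gdist x y = 0 \<longleftrightarrow> x = y"
  using gdist_relpow by fastforce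

lemma gdist_triangle:
  assumes "x \<in> V" "y \<in> V" "z \<in> V"
  shows "gdist x z \<le> gdist x y + gdist y z"
  using gdist_le relpow_trans gdist_relpow assms by metis

lemma gdist_edge_le: "(x, y) \<in> E \<Longrightarrow> gdist x y \<le> 1"
  by (rule gdist_le) simp

lemma gdist_edge_lipschitz:
  assumes "(x, y) \<in> E" "r \<in> V"
  shows "gdist x r \<le> gdist y r + 1"
  using gdist_triangle[of x y r] gdist_edge_le[OF assms(1)] edge_verts[OF assms(1)] assms(2)
  by linarith

text \<open>Cut a shortest walk after \<open>j\<close> steps; the triangle inequality leaves no
  slack in either part.\<close>

lemma gdist_intermediate:
  assumes "x \<in> V" "y \<in> V" "j \<le> gdist x y"
  obtains w where "w \<in> V" "gdist x w = j" "gdist w y = gdist x y - j"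
proof -
  have "(x, y) \<in> E ^^ (j + (gdist x y - j))"
    using gdist_relpow assms by simp
  then obtain w where w: "(x, w) \<in> E ^^ j" "(w, y) \<in> E ^^ (gdist x y - j)"
    by (auto simp only: relpow_add)
  have "w \<in> V"
    using w(1) assms(1) by (cases j) (auto dest: edge_verts)
  moreover have "gdist x w \<le> j" "gdist w y \<le> gdist x y - j"
    using w by (auto intro: gdist_le)
  ultimately show thesis
    using gdist_triangle[of x w y] assms that[of w] by linarith
qed

lemma gdist_step:
  assumes "x \<in> V" "y \<in> V" "0 < gdist x y"
  obtains w where "(x, w) \<in> E" "gdist w y = gdist x y - 1"
proof -
  obtain w where w: "w \<in> V" "gdist x w = 1" "gdist w y = gdist x y - 1"
    using gdist_intermediate[of x y 1] assms by auto
  then show thesis using that gdist_relpow[of x w] assms(1) by simp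
qed

lemma gdist_edge: "(x, y) \<in> E \<Longrightarrow> gdist x y = 1"
  using gdist_edge_le[of x y] gdist_0_iff[of x y] edge_verts[of x y] edge_neq[of x y] by fastforce

lemma E3_sym: "(x, y) \<in> E3 \<Longrightarrow> (y, x) \<in> E3"
  unfolding E3_def using gdist_sym by auto

lemma E3_rtrancl_sym: "(x, y) \<in> E3\<^sup>* \<Longrightarrow> (y, x) \<in> E3\<^sup>*"
  using sym_rtrancl[of E3] E3_sym by (meson symD symI)

lemma E3_common_neighbour: "(x, w) \<in> E3 \<Longrightarrow> (y, w) \<in> E3 \<Longrightarrow> (x, y) \<in> E3\<^sup>*"
  using E3_sym by (meson converse_rtrancl_into_rtrancl r_into_rtrancl)

text \<open>Strong induction on the distance: a jump of 3 steps along a geodesic towards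
  \<open>u\<close> is an arc of \<open>E3\<close> and keeps the residue modulo 3.\<close>

lemma E3_to_near:
  assumes "u \<in> V" "x \<in> V"
  shows "\<exists>y\<in>V. (x, y) \<in> E3\<^sup>* \<and> gdist u y = gdist u x mod 3"
  using assms(2)
proof (induction "gdist u x" arbitrary: x rule: less_induct)
  case less
  show ?case
  proof (cases "gdist u x < 3")
    case True
    then show ?thesis using less.prems by auto
  next
    case False
    then obtain w where w: "w \<in> V" "gdist x w = 3" "gdist w u = gdist x u - 3"
      using gdist_intermediate[of x u 3] less.prems assms(1) gdist_sym[of u x]
      by (metis not_less)
    have d: "gdist u w = gdist u x - 3"
      using w(3) gdist_sym by metis
    then have "gdist u w < gdist u x" "gdist u w mod 3 = gdist u x mod 3"
      using False by (auto simp: le_mod_geq)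
    then obtain y where "y \<in> V" "(w, y) \<in> E3\<^sup>*" "gdist u y = gdist u x mod 3"
      using less.hyps[of w] w(1) by auto
    moreover have "(x, w) \<in> E3"
      using w less.prems by (simp add: E3_def)
    ultimately show ?thesis
      by (meson converse_rtrancl_into_rtrancl)
  qed
qed

end

section \<open>Components of the 3-distance relation when the girth is at least 6\<close>

locale girth6_graph = connected_graph +
  assumes no_triangle: "(a, b) \<in> E \<Longrightarrow> (b, c) \<in> E \<Longrightarrow> (c, a) \<notin> E"
    and no_4_cycle: "\<lbrakk>(a, b) \<in> E; (b, c) \<in> E; (c, d) \<in> E; (d, a) \<in> E\<rbrakk> \<Longrightarrow> a = c \<or> b = d"
    and no_5_cycle: "\<lbrakk>(a, b) \<in> E; (b, c) \<in> E; (c, d) \<in> E; (d, e) \<in> E; (e, a) \<in> E\<rbrakk> \<Longrightarrow>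
      \<not> distinct [a, b, c, d, e]"
begin

lemma gdist_path2:
  assumes "(x, y) \<in> E" "(y, z) \<in> E" "x \<noteq> z"
  shows "gdist x z = 2"
proof -
  have V: "x \<in> V" "y \<in> V" "z \<in> V" using assms edge_verts by blast+
  have "gdist x z \<noteq> 0" using gdist_0_iff V assms(3) by blast
  moreover have "gdist x z \<le> 2"
    using gdist_triangle[OF V] gdist_edge[OF assms(1)] gdist_edge[OF assms(2)] by simp
  moreover have "gdist x z \<noteq> 1"
  proof
    assume "gdist x z = 1"
    then have "(z, x) \<in> E" using gdist_relpow[OF V(1,3)] edge_sym by simp
    then show False using no_triangle assms by blast
  qed
  ultimately show ?thesis by linarith
qed

text \<open>A shorter connection of the ends would close a cycle of length 3, 4 or 5. Hence every
  walk of length 3 without backtracking joins its ends in \<open>E3\<close>.\<close>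

lemma gdist_path3:
  assumes "(w, x) \<in> E" "(x, y) \<in> E" "(y, z) \<in> E" "w \<noteq> y" "x \<noteq> z"
  shows "gdist w z = 3"
proof -
  have V: "w \<in> V" "x \<in> V" "z \<in> V" using assms edge_verts by blast+
  have "w \<noteq> z" using assms no_triangle by blast
  have le: "gdist w z \<le> 3"
    using gdist_triangle[of w x z] gdist_edge[OF assms(1)] gdist_path2[OF assms(2,3,5)] V by simp
  have n1: "gdist w z \<noteq> 1"
  proof
    assume "gdist w z = 1"
    then have "(z, w) \<in> E" using gdist_relpow[OF V(1,3)] edge_sym by simp
    then show False using no_4_cycle[of w x y z] assms by blast
  qed
  have n2: "gdist w z \<noteq> 2"
  proof
    assume "gdist w z = 2"
    then have "(w, z) \<in> E ^^ Suc (Suc 0)" using gdist_relpow[OF V(1,3)] by (simp add: numeral_2_eq_2)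
    then obtain c where c: "(w, c) \<in> E" "(c, z) \<in> E" by auto
    have "c \<noteq> x" "c \<noteq> y"
      using c assms no_triangle[of x y z] no_triangle[of w x y] edge_sym by blast+
    moreover have "distinct [w, x, y, z]"
      using assms \<open>w \<noteq> z\<close> edge_neq by auto
    ultimately have "distinct [w, x, y, z, c]"
      using c edge_neq by auto
    then show False
      using no_5_cycle[of w x y z c] c assms edge_sym by blast
  qed
  have "gdist w z \<noteq> 0" using \<open>w \<noteq> z\<close> gdist_0_iff V by blast
  with le n1 n2 show ?thesis by linarith
qed

text \<open>Every neighbour of \<open>u\<close> other than \<open>a\<close> is at distance 3 from
  \<open>a'\<close>, and every one other than \<open>b\<close> is at distance 3 from
  \<open>b'\<close>. So \<open>c\<close> shares \<open>a'\<close> with all neighbours except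
  \<open>a\<close>, and it shares \<open>b'\<close> with \<open>a\<close>. A vertex at distance 2
  jumps over \<open>u\<close> to a neighbour.\<close>

lemma branching_near_connected:
  assumes "branching E u"
    and "x \<in> V" "gdist u x \<in> {1, 2}"
    and "y \<in> V" "gdist u y \<in> {1, 2}"
  shows "(x, y) \<in> E3\<^sup>*"
proof -
  obtain a b c a' b' where neq: "a \<noteq> b" "a \<noteq> c" "b \<noteq> c"
    and nb: "(u, a) \<in> E" "(u, b) \<in> E" "(u, c) \<in> E"
    and a': "(a, a') \<in> E" "a' \<noteq> u" and b': "(b, b') \<in> E" "b' \<noteq> u"
    using assms(1) unfolding branching_def by blast
  have uV: "u \<in> V" using nb edge_verts by blast
  have link: "(p, q') \<in> E3" if "(u, p) \<in> E" "(u, q) \<in> E" "p \<noteq> q" "(q, q') \<in> E" "q' \<noteq> u" for p q q'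
    using gdist_path3[of p u q q'] that edge_sym edge_verts unfolding E3_def by blast
  have bc: "(b, c) \<in> E3\<^sup>*"
    using E3_common_neighbour[OF link[OF nb(2,1) _ a'] link[OF nb(3,1) _ a']] neq by metis
  have ac: "(a, c) \<in> E3\<^sup>*"
    using E3_common_neighbour[OF link[OF nb(1,2) _ b'] link[OF nb(3,2) _ b']] neq by metis
  have nbr: "(p, c) \<in> E3\<^sup>*" if "(u, p) \<in> E" for p
  proof (cases "p = a")
    case False
    then show ?thesis
      using E3_common_neighbour[OF link[OF that nb(1) _ a'] link[OF nb(3,1) _ a']] neq by metis
  qed (use ac in simp)
  have near: "(p, c) \<in> E3\<^sup>*" if p: "p \<in> V" "gdist u p \<in> {1, 2}" for p
  proof (cases "gdist u p = 1")
    case True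
    then show ?thesis using gdist_relpow[OF uV p(1)] nbr by simp
  next
    case False
    then have 2: "gdist u p = 2" using p(2) by simp
    then obtain q where q: "(u, q) \<in> E" "gdist q p = 1"
      using gdist_step[OF uV p(1)] by auto
    then have qp: "(q, p) \<in> E" using gdist_relpow[of q p] edge_verts p(1) by fastforce
    have pu: "p \<noteq> u" using 2 by auto
    obtain r where "(u, r) \<in> E" "r \<noteq> q" using neq nb by metis
    then show ?thesis
      using link[of r q p] q(1) qp pu nbr[of r] E3_sym by (meson converse_rtrancl_into_rtrancl)
  qed
  show ?thesis
    using near[OF assms(2,3)] near[OF assms(4,5)] E3_rtrancl_sym by (meson rtrancl_trans)
qed

text \<open>The jumps towards \<open>u\<close> end at distance 0, that is, at \<open>u\<close>
  itself.\<close>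

lemma E3_class0:
  assumes "u \<in> V" "x \<in> V" "3 dvd gdist u x"
  shows "(u, x) \<in> E3\<^sup>*"
  using E3_to_near[OF assms(1,2)] assms gdist_0_iff E3_rtrancl_sym by fastforce

lemma branching_class_rest:
  assumes "branching E u" "x \<in> V" "y \<in> V" "\<not> 3 dvd gdist u x" "\<not> 3 dvd gdist u y"
  shows "(x, y) \<in> E3\<^sup>*"
proof -
  have u: "u \<in> V" using assms(1) edge_verts unfolding branching_def by blast
  have near: "\<exists>p\<in>V. (z, p) \<in> E3\<^sup>* \<and> gdist u p \<in> {1, 2}" if z: "z \<in> V" "\<not> 3 dvd gdist u z" for z
  proof -
    have "gdist u z mod 3 \<in> {1, 2}" using z(2) by auto presburger
    then show ?thesis using E3_to_near[OF u z(1)] by metis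
  qed
  obtain p q where "p \<in> V" "q \<in> V" "(x, p) \<in> E3\<^sup>*" "(y, q) \<in> E3\<^sup>*"
    "gdist u p \<in> {1, 2}" "gdist u q \<in> {1, 2}"
    using near[OF assms(2,4)] near[OF assms(3,5)] by blast
  then show ?thesis
    using branching_near_connected[OF assms(1)] E3_rtrancl_sym by (meson rtrancl_trans)
qed

text \<open>Each of the two classes around \<open>u\<close> is connected, so one link between them
  is enough; the second vertex \<open>w\<close> supplies it.\<close>

lemma E3_connected:
  assumes u: "branching E u" and w: "branching E w" and d: "\<not> 3 dvd gdist u w"
    and "x \<in> V" "y \<in> V"
  shows "(x, y) \<in> E3\<^sup>*"
proof -
  have uV: "u \<in> V" and wV: "w \<in> V"
    using u w edge_verts unfolding branching_def by blast+
  \<comment> \<open>Then \<open>u\<close> and \<open>p\<close> lie in the same class around \<open>w\<close>, but in different classes around \<open>u\<close>.\<close>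
  obtain p where p: "p \<in> V" "\<not> 3 dvd gdist u p" "\<not> 3 dvd gdist w p"
  proof -
    have "\<exists>p\<in>V. \<not> 3 dvd gdist u p \<and> \<not> 3 dvd gdist p w"
    proof -
      \<comment> \<open>In the first and third case a geodesic vertex one or two steps from
        \<open>u\<close> works, as the remaining distance is again not divisible by 3. At distance 1
        the geodesic has no interior vertex, so another neighbour of \<open>u\<close> is taken,
        which is at distance 2 from \<open>w\<close>.\<close>
      consider "gdist u w mod 3 = 2" | "gdist u w = 1" | "gdist u w mod 3 = 1" "2 \<le> gdist u w"
        using mod3_cases[OF d] by blast
      then show ?thesis
      proof cases
        case 1
        then obtain p where "p \<in> V" "gdist u p = 1" "gdist p w = gdist u w - 1"
          using gdist_intermediate[OF uV wV, of 1] by (metis One_nat_def Suc_leI mod_0 neq0_conv zero_neq_numeral)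
        then show ?thesis using 1 by (intro bexI[of _ p]) presburger+
      next
        case 2
        then have uw: "(u, w) \<in> E" using gdist_relpow[OF uV wV] by simp
        obtain p where p: "(u, p) \<in> E" "p \<noteq> w" using u unfolding branching_def by metis
        then have "gdist p w = 2" using gdist_path2[of p u w] uw edge_sym by blast
        then show ?thesis
          using gdist_edge[OF p(1)] edge_verts(2)[OF p(1)] by (intro bexI[of _ p]) auto
      next
        case 3
        then obtain p where "p \<in> V" "gdist u p = 2" "gdist p w = gdist u w - 2"
          using gdist_intermediate[OF uV wV, of 2] by metis
        then show ?thesis using 3 by (intro bexI[of _ p]) presburger+
      qed
    qed
    then show thesis using that gdist_sym by metis
  qed
  have pu: "(p, u) \<in> E3\<^sup>*"
    using branching_class_rest[OF w p(1) uV p(3)] d gdist_sym by metis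
  have "(z, p) \<in> E3\<^sup>*" if "z \<in> V" for z
  proof (cases "3 dvd gdist u z")
    case True
    then show ?thesis
      using E3_class0[OF uV that] pu E3_rtrancl_sym by (meson rtrancl_trans)
  next
    case False
    then show ?thesis using branching_class_rest[OF u that p(1)] p(2) by blast
  qed
  then show ?thesis
    using assms(4,5) E3_rtrancl_sym by (meson rtrancl_trans)
qed

end

section \<open>Phases around the cycle\<close>

text \<open>Cut the walk after its last visit to \<open>x\<close>; the rest avoids
  \<open>x\<close>.\<close>

lemma rtrancl_leave:
  assumes "(x, y) \<in> R\<^sup>*" "x \<noteq> y"
  shows "\<exists>b. (x, b) \<in> R \<and> (b, y) \<in> {(p, q) \<in> R. p \<noteq> x \<and> q \<noteq> x}\<^sup>*"
  using assms
proof (induction rule: rtrancl_induct)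
  case (step y z)
  show ?case
  proof (cases "x = y")
    case False
    then obtain b where "(x, b) \<in> R" "(b, y) \<in> {(p, q) \<in> R. p \<noteq> x \<and> q \<noteq> x}\<^sup>*"
      using step.IH by blast
    moreover have "(y, z) \<in> {(p, q) \<in> R. p \<noteq> x \<and> q \<noteq> x}"
      using step.hyps(2) step.prems False by auto
    ultimately show ?thesis by (meson rtrancl_into_rtrancl)
  qed (use step.hyps(2) in auto)
qed simp

text \<open>Without a turn, \<open>x\<close>, \<open>a\<close> and \<open>b\<close> use all three
  colours and \<open>y\<close> repeats \<open>x\<close>. A turn puts \<open>c\<close> on
  \<open>a\<close> or on \<open>b\<close>, and then neither end has colour \<open>c\<close>.\<close>

lemma three_colours_path:
  fixes x a b y c :: int
  assumes x: "x \<in> {0, 1, 2}" and a: "a \<in> {0, 1, 2}" and b: "b \<in> {0, 1, 2}" and y: "y \<in> {0, 1, 2}"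
    and neq: "x \<noteq> a" "a \<noteq> b" "b \<noteq> y" and turn: "x = b \<Longrightarrow> a = c" "y = a \<Longrightarrow> b = c"
  shows "x = c \<longleftrightarrow> y = c"
proof (cases "x = b \<or> y = a")
  case True
  then show ?thesis using neq turn by metis
next
  case False
  then have "x \<noteq> b" "y \<noteq> a" by blast+
  then have "x = y" using x a b y neq by fastforce
  then show ?thesis by simp
qed

lemma mod_3_add_cancel:
  fixes a b c d :: int
  assumes "a mod 3 = b mod 3" "(a + c) mod 3 = (b + d) mod 3"
  shows "c mod 3 = d mod 3"
  using mod_diff_cong[OF assms(2,1)] by simp

text \<open>Numbers one step from \<open>c\<close> differ by 0 or 2. In
  \<open>branching_turn\<close> this turns equal phases of two tree neighbours into equal
  depths.\<close>

lemma mod_3_eq_steps: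
  fixes a b c :: nat
  assumes "int a mod 3 = int b mod 3" "a = c + 1 \<or> c = a + 1" "b = c + 1 \<or> c = b + 1"
  shows "a = b"
proof -
  have "int k mod 3 \<noteq> int (k + 2) mod 3" for k by presburger
  moreover have "a = b \<or> a = b + 2 \<or> b = a + 2" using assms(2,3) by auto
  ultimately show ?thesis using assms(1) by metis
qed

text \<open>
  The cycle is parametrised by the integers modulo its length. The last assumption is all that is
  needed from the uniqueness of the cycle: an edge whose ends remain connected after its removal
  lies on a cycle, hence on this one.
\<close>

locale cycle_graph = connected_graph +
  fixes n :: int and v :: "int \<Rightarrow> 'a"
  assumes n_ge_3: "n \<ge> 3"
    and v_eq_iff: "v i = v j \<longleftrightarrow> [i = j] (mod n)"
    and v_edge: "(v i, v (i + 1)) \<in> E"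
    and non_bridge: "(a, b) \<in> E \<Longrightarrow> (b, a) \<in> (E - {(a, b), (b, a)})\<^sup>* \<Longrightarrow> \<exists>i. {a, b} = {v i, v (i + 1)}"
begin

definition cycle_edges :: "'a rel" where
  "cycle_edges = range (\<lambda>i. (v i, v (i + 1))) \<union> range (\<lambda>i. (v (i + 1), v i))"

text \<open>These are the trees hanging on the cycle: through them every vertex is joined to exactly
  one cycle vertex, by \<open>ex_root\<close> and \<open>tree_connected_cycle_verts\<close>.\<close>

definition tree_edges :: "'a rel" where
  "tree_edges = E - cycle_edges"

lemma v_in_V: "v i \<in> V"
  using v_edge edge_verts by blast

lemma cycle_edges_sym: "(x, y) \<in> cycle_edges \<Longrightarrow> (y, x) \<in> cycle_edges"
  unfolding cycle_edges_def by auto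

lemma cycle_edges_sub: "cycle_edges \<subseteq> E"
  unfolding cycle_edges_def using v_edge edge_sym by auto

lemma tree_edges_sym: "(x, y) \<in> tree_edges \<Longrightarrow> (y, x) \<in> tree_edges"
  unfolding tree_edges_def using edge_sym cycle_edges_sym by auto

lemma tree_rtrancl_sym: "(x, y) \<in> tree_edges\<^sup>* \<Longrightarrow> (y, x) \<in> tree_edges\<^sup>*"
  using sym_rtrancl[of tree_edges] tree_edges_sym by (meson symD symI)

lemma tree_edgeD: "(x, y) \<in> tree_edges \<Longrightarrow> (x, y) \<in> E"
  unfolding tree_edges_def by simp

lemma tree_edgeI: "(x, y) \<in> E \<Longrightarrow> x \<notin> range v \<Longrightarrow> (x, y) \<in> tree_edges"
  unfolding tree_edges_def cycle_edges_def by auto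

lemma cycle_nbr:
  assumes "(v i, x) \<in> cycle_edges"
  shows "x = v (i + 1) \<or> x = v (i - 1)"
proof -
  consider j where "v i = v j" "x = v (j + 1)" | j where "v i = v (j + 1)" "x = v j"
    using assms unfolding cycle_edges_def by auto
  then show ?thesis
  proof cases
    case 1
    then have "[i + 1 = j + 1] (mod n)" using v_eq_iff cong_add_rcancel by blast
    then show ?thesis using 1 v_eq_iff by metis
  next
    case 2
    then have "[i - 1 = j + 1 - 1] (mod n)" using v_eq_iff cong_diff cong_refl by blast
    then show ?thesis using 2 v_eq_iff by (metis add_diff_cancel_right')
  qed
qed

lemma cycle_edge_cong:
  assumes "(v i, v j) \<in> cycle_edges"
  shows "[j = i + 1] (mod n) \<or> [j = i - 1] (mod n)"
  using cycle_nbr[OF assms] v_eq_iff by blast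

lemma v_neq_2: "v (i + 1) \<noteq> v (i - 1)"
proof
  assume "v (i + 1) = v (i - 1)"
  then have "n dvd 2" using v_eq_iff by (simp add: cong_iff_dvd_diff)
  then show False using n_ge_3 zdvd_imp_le by fastforce
qed

lemma v_relpow: "(v i, v (i + int k)) \<in> cycle_edges ^^ k"
proof (induction k)
  case (Suc k)
  have "(v (i + int k), v (i + int k + 1)) \<in> cycle_edges"
    unfolding cycle_edges_def by blast
  then show ?case using Suc by (auto simp: algebra_simps)
qed simp

lemma v_add_mod: "v (i + (j - i) mod n) = v j"
  unfolding v_eq_iff by (simp add: cong_def mod_simps)

lemma v_connected: "(v i, v j) \<in> cycle_edges\<^sup>*"
proof -
  have "(v i, v (i + int (nat ((j - i) mod n)))) \<in> cycle_edges\<^sup>*"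
    using v_relpow by (rule relpow_imp_rtrancl)
  then show ?thesis using v_add_mod n_ge_3 by simp
qed

section \<open>Trees attached to the cycle: roots, depths and parents\<close>

lemma non_bridge_cycle_edge:
  assumes "(a, b) \<in> E" "(b, a) \<in> (E - {(a, b), (b, a)})\<^sup>*"
  shows "(a, b) \<in> cycle_edges"
  using non_bridge[OF assms] unfolding cycle_edges_def by (auto simp: doubleton_eq_iff)

text \<open>Otherwise the tree walk leaves \<open>v i\<close> for the last time by some edge to
  \<open>b\<close>, reaches \<open>v j\<close>, and returns to \<open>v i\<close> along the cycle.
  Then that edge is no bridge, so it lies on the cycle.\<close>

lemma tree_connected_cycle_verts:
  assumes "(v i, v j) \<in> tree_edges\<^sup>*"
  shows "v i = v j"
proof (rule ccontr)
  assume "v i \<noteq> v j"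
  then obtain b where b: "(v i, b) \<in> tree_edges"
    "(b, v j) \<in> {(p, q) \<in> tree_edges. p \<noteq> v i \<and> q \<noteq> v i}\<^sup>*"
    using rtrancl_leave[OF assms] by blast
  let ?R = "E - {(v i, b), (b, v i)}"
  have "(b, v j) \<in> ?R\<^sup>*"
    using b(2) by (rule rtrancl_mono[THEN subsetD, rotated]) (auto simp: tree_edges_def)
  moreover have "(v j, v i) \<in> ?R\<^sup>*"
    using v_connected[of j i]
    by (rule rtrancl_mono[THEN subsetD, rotated])
      (use b(1) cycle_edges_sub cycle_edges_sym in \<open>auto simp: tree_edges_def\<close>)
  ultimately have "(v i, b) \<in> cycle_edges"
    using non_bridge_cycle_edge b(1) tree_edgeD by (meson rtrancl_trans)
  then show False using b(1) by (simp add: tree_edges_def)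
qed

lemma ex_root: 
  assumes "x \<in> V"
  shows "\<exists>i. (x, v i) \<in> tree_edges\<^sup>*"
proof -
  have "(x, v 0) \<in> E\<^sup>*" using connected_verts assms v_in_V by blast
  then show ?thesis
  proof (induction rule: converse_rtrancl_induct)
    case (step x y)
    show ?case
    proof (cases "(x, y) \<in> tree_edges")
      case True
      then show ?thesis using step.IH by (meson converse_rtrancl_into_rtrancl)
    next
      case False
      then have "x \<in> range v" using step.hyps(1) tree_edgeI by blast
      then show ?thesis by auto
    qed
  qed auto
qed

text \<open>An index instead of a vertex, so that it can enter arithmetic modulo 3.\<close>

definition root :: "'a \<Rightarrow> int" where
  "root x = (SOME i. (x, v i) \<in> tree_edges\<^sup>*)"

text \<open>Measured in the whole graph, so that geodesics and
  \<open>two_descents_cycle_edge\<close> apply directly.\<close>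

definition depth :: "'a \<Rightarrow> nat" where
  "depth x = gdist x (v (root x))"

lemma root_connected: "x \<in> V \<Longrightarrow> (x, v (root x)) \<in> tree_edges\<^sup>*"
  unfolding root_def using ex_root by (rule someI_ex)

lemma tree_edge_v_root:
  assumes "(x, y) \<in> tree_edges"
  shows "v (root x) = v (root y)"
proof -
  have "x \<in> V" "y \<in> V" using assms tree_edgeD edge_verts by blast+
  then have "(v (root x), x) \<in> tree_edges\<^sup>*" "(y, v (root y)) \<in> tree_edges\<^sup>*"
    using root_connected tree_rtrancl_sym by auto
  then show ?thesis
    using assms by (meson tree_connected_cycle_verts rtrancl_trans r_into_rtrancl)
qed

lemma v_root_v [simp]: "v (root (v i)) = v i"
  using tree_connected_cycle_verts root_connected v_in_V by metis

lemma root_v_cong: "[root (v i) = i] (mod n)"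
  using v_root_v v_eq_iff by blast

lemma depth_v [simp]: "depth (v i) = 0"
  unfolding depth_def by simp

lemma depth_0_iff: "x \<in> V \<Longrightarrow> depth x = 0 \<longleftrightarrow> x \<in> range v"
  using gdist_0_iff[of x "v (root x)"] v_in_V by (auto simp: depth_def)

text \<open>Along a geodesic from \<open>x\<close> the distance to \<open>r\<close> drops below that
  of \<open>a\<close> after the first step, so \<open>a\<close> is never met.\<close>

lemma path_avoiding:
  assumes "r \<in> V" "x \<in> V" "a \<in> V" "x \<noteq> a" "gdist x r \<le> gdist a r"
  shows "(x, r) \<in> {(p, q) \<in> E. p \<noteq> a \<and> q \<noteq> a}\<^sup>*"
  using assms(2,4,5)
proof (induction "gdist x r" arbitrary: x rule: less_induct)
  case less
  show ?case
  proof (cases "gdist x r = 0")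
    case True
    then show ?thesis using gdist_0_iff less.prems assms by auto
  next
    case False
    then obtain w where w: "(x, w) \<in> E" "gdist w r = gdist x r - 1"
      using gdist_step[OF less.prems(1) assms(1)] by auto
    have "w \<noteq> a" using w(2) less.prems(3) False by auto
    then have "(w, r) \<in> {(p, q) \<in> E. p \<noteq> a \<and> q \<noteq> a}\<^sup>*"
      using less.hyps[of w] w less.prems False edge_verts by simp
    then show ?thesis
      using w(1) \<open>w \<noteq> a\<close> less.prems(2)
      by (intro converse_rtrancl_into_rtrancl[of x w]) auto
  qed
qed

text \<open>
  If \<open>a\<close> has two neighbours that are no farther from \<open>r\<close> than \<open>a\<close> itself, then geodesics from both
  to \<open>r\<close> avoid \<open>a\<close>, so neither of the two edges is a bridge.
\<close>

lemma two_descents_cycle_edge: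
  assumes "r \<in> V" "(a, x) \<in> E" "(a, b) \<in> E" "x \<noteq> b"
    and "gdist x r \<le> gdist a r" "gdist b r \<le> gdist a r"
  shows "(a, x) \<in> cycle_edges"
proof -
  let ?R = "{(p, q) \<in> E. p \<noteq> a \<and> q \<noteq> a}"
  have V: "a \<in> V" "x \<in> V" "b \<in> V" using assms edge_verts by blast+
  have neq: "x \<noteq> a" "b \<noteq> a" using assms edge_neq by blast+
  have "(x, r) \<in> ?R\<^sup>*" using path_avoiding assms V neq by blast
  moreover have "(r, b) \<in> ?R\<^sup>*"
  proof -
    have "(b, r) \<in> ?R\<^sup>*" using path_avoiding assms V neq by blast
    moreover have "sym ?R" using edge_sym by (auto intro: symI)
    ultimately show ?thesis using sym_rtrancl by (meson symD)
  qed
  ultimately have "(x, b) \<in> ?R\<^sup>*" by (rule rtrancl_trans)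
  then have "(x, b) \<in> (E - {(a, x), (x, a)})\<^sup>*"
    by (rule rtrancl_mono[THEN subsetD, rotated]) auto
  moreover have "(b, a) \<in> E - {(a, x), (x, a)}"
    using assms(3,4) neq edge_sym by auto
  ultimately show ?thesis
    using non_bridge_cycle_edge[OF assms(2)] by (meson rtrancl_into_rtrancl)
qed

text \<open>Both depths are distances to the same root vertex and differ by at most 1. If they were
  equal, \<open>x\<close> and the next vertex on a geodesic from \<open>a\<close> would be two
  descents, and the edge would lie on the cycle.\<close>

lemma tree_edge_depth:
  assumes "(a, x) \<in> tree_edges"
  shows "depth x = depth a + 1 \<or> depth a = depth x + 1"
proof -
  let ?r = "v (root a)"
  have ax: "(a, x) \<in> E" and V: "a \<in> V" "x \<in> V"
    using assms tree_edgeD edge_verts by blast+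
  have d: "depth x = gdist x ?r" "depth a = gdist a ?r"
    using tree_edge_v_root[OF assms] by (simp_all add: depth_def)
  have "gdist x ?r \<noteq> gdist a ?r"
  proof
    assume eq: "gdist x ?r = gdist a ?r"
    have "gdist a ?r \<noteq> 0"
      using eq gdist_0_iff V v_in_V edge_neq[OF ax] by metis
    then obtain p where p: "(a, p) \<in> E" "gdist p ?r = gdist a ?r - 1"
      using gdist_step[OF V(1) v_in_V] by blast
    then have "x \<noteq> p" using eq \<open>gdist a ?r \<noteq> 0\<close> by auto
    then have "(a, x) \<in> cycle_edges"
      using two_descents_cycle_edge[of ?r a x p] v_in_V ax p eq by simp
    then show False using assms by (simp add: tree_edges_def)
  qed
  moreover have "gdist x ?r \<le> gdist a ?r + 1" "gdist a ?r \<le> gdist x ?r + 1"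
    using gdist_edge_lipschitz ax edge_sym v_in_V by blast+
  ultimately show ?thesis using d by linarith
qed

lemma parent_unique:
  assumes "(a, x) \<in> tree_edges" "(a, y) \<in> tree_edges" "depth x < depth a" "depth y < depth a"
  shows "x = y"
proof (rule ccontr)
  assume "x \<noteq> y"
  moreover have "depth x = gdist x (v (root a))" "depth y = gdist y (v (root a))"
    using tree_edge_v_root[OF assms(1)] tree_edge_v_root[OF assms(2)] by (simp_all add: depth_def)
  ultimately have "(a, x) \<in> cycle_edges"
    using two_descents_cycle_edge[of "v (root a)" a x y] assms v_in_V
    by (simp add: tree_edges_def depth_def)
  then show False using assms(1) by (simp add: tree_edges_def)
qed

text \<open>The parent has a further neighbour, either along the cycle or its own parent, so it can
  serve as one of the two neighbours of degree at least 2 in \<open>branching\<close>.\<close>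

lemma ex_parent:
  assumes "a \<in> V" "a \<notin> range v"
  obtains p p' where "(a, p) \<in> tree_edges" "depth p < depth a" "(p, p') \<in> E" "p' \<noteq> a"
proof -
  have "0 < depth a" using depth_0_iff assms by blast
  then obtain p where p: "(a, p) \<in> E" "gdist p (v (root a)) = depth a - 1"
    using gdist_step[OF assms(1) v_in_V[of "root a"]] unfolding depth_def by blast
  have pt: "(a, p) \<in> tree_edges" using tree_edgeI p(1) assms(2) by blast
  then have pd: "depth p < depth a"
    using p(2) tree_edge_v_root[OF pt] \<open>0 < depth a\<close> by (simp add: depth_def)
  have "\<exists>p'. (p, p') \<in> E \<and> p' \<noteq> a"
  proof (cases "p \<in> range v")
    case True
    then obtain i where "p = v i" by blast
    then show ?thesis using v_edge[of i] assms(2) by blast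
  next
    case False
    have pV: "p \<in> V" using p(1) edge_verts by blast
    then have "0 < depth p" using False depth_0_iff by blast
    then obtain p' where p': "(p, p') \<in> E" "gdist p' (v (root p)) = depth p - 1"
      using gdist_step[OF pV v_in_V[of "root p"]] unfolding depth_def by blast
    then have "depth p' < depth p"
      using tree_edge_v_root[OF tree_edgeI[OF p'(1) False]] \<open>0 < depth p\<close>
      by (simp add: depth_def)
    then show ?thesis using p'(1) pd by auto
  qed
  then show thesis using that pt pd by blast
qed

text \<open>The two cycle neighbours continue along the cycle, and the tree edge gives the third
  neighbour.\<close>

lemma branching_attachment:
  assumes "(v i, x) \<in> tree_edges"
  shows "branching E (v i)"
proof -
  have "x \<noteq> v (i + 1)" "x \<noteq> v (i - 1)"
    using assms unfolding tree_edges_def cycle_edges_def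
    by (auto simp: image_iff)
  moreover have "(v i, v (i - 1)) \<in> E" "(v (i - 1), v (i - 1 - 1)) \<in> E"
    using v_edge[of "i - 1"] v_edge[of "i - 1 - 1"] edge_sym by auto
  moreover have "v (i + 1 + 1) \<noteq> v i" "v (i - 1 - 1) \<noteq> v i"
    using v_neq_2[of "i + 1"] v_neq_2[of "i - 1"] by simp_all
  ultimately show ?thesis
    using branchingI[of "v (i + 1)" "v (i - 1)" x "v i" E "v (i + 1 + 1)" "v (i - 1 - 1)"]
      v_neq_2[of i] v_edge[of i] v_edge[of "i + 1"] tree_edgeD[OF assms] by simp
qed

text \<open>A branching vertex off the cycle lies in a nontrivial tree, which makes its root an
  attachment vertex. So the depth of a branching vertex is itself a distance between two branching
  vertices.\<close>

lemma branching_root: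
  assumes "branching E u"
  shows "branching E (v (root u))"
proof (cases "u \<in> range v")
  case True
  then show ?thesis using assms by auto
next
  case False
  have "u \<in> V" using assms edge_verts unfolding branching_def by blast
  then have "(u, v (root u)) \<in> tree_edges\<^sup>*" "u \<noteq> v (root u)"
    using root_connected False by auto
  then obtain p where "(p, v (root u)) \<in> tree_edges"
    by (meson rtranclE)
  then show ?thesis using branching_attachment tree_edges_sym by blast
qed

section \<open>Distances between cycle vertices\<close>

text \<open>The distance between positions 0 and \<open>k\<close> on a cycle of length
  \<open>n\<close>, the minimum over the two directions.\<close>

definition cyc_dist :: "int \<Rightarrow> int" where
  "cyc_dist k = min (k mod n) ((- k) mod n)"

lemma cyc_dist_minus [simp]: "cyc_dist (- k) = cyc_dist k"
  by (simp add: cyc_dist_def min.commute)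

lemma cyc_dist_cong: "[k = l] (mod n) \<Longrightarrow> cyc_dist k = cyc_dist l"
  unfolding cyc_dist_def cong_def by (metis mod_minus_eq)

lemma cyc_dist_Suc: "cyc_dist (k + 1) \<le> cyc_dist k + 1"
proof -
  have pos: "0 < n" using n_ge_3 by simp
  have "(k + 1) mod n = (k mod n + 1) mod n" by (simp add: mod_simps)
  also have "\<dots> \<le> k mod n + 1" using pos by (intro zmod_le_nonneg_dividend) simp
  finally have 1: "(k + 1) mod n \<le> k mod n + 1" .
  show ?thesis
  \<comment> \<open>At residue 0 the backward count wraps to \<open>n - 1\<close>, but the forward
    bound alone suffices there.\<close>
  proof (cases "(- k) mod n = 0")
    case True
    then have "k mod n = 0" by (simp add: mod_eq_0_iff_dvd)
    then show ?thesis using 1 True by (simp add: cyc_dist_def)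
  next
    case False
    have "(- (k + 1)) mod n = ((- k) mod n - 1) mod n" by (simp add: mod_simps)
    also have "\<dots> \<le> (- k) mod n - 1"
      using False pos pos_mod_sign[of n "- k"] by (intro zmod_le_nonneg_dividend) linarith
    finally show ?thesis using 1 by (simp add: cyc_dist_def)
  qed
qed

lemma cyc_dist_pred: "cyc_dist (k - 1) \<le> cyc_dist k + 1"
  using cyc_dist_Suc[of "- k"] cyc_dist_minus[of "k - 1"] by simp

lemma root_tree_edge_cong: "(x, y) \<in> tree_edges \<Longrightarrow> [root x = root y] (mod n)"
  using tree_edge_v_root v_eq_iff by blast

lemma edge_cases:
  assumes "(x, y) \<in> E"
  obtains "(x, y) \<in> tree_edges"
  | "x \<in> range v" "y \<in> range v" "[root y = root x + 1] (mod n)"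
  | "x \<in> range v" "y \<in> range v" "[root y = root x - 1] (mod n)"
proof (cases "(x, y) \<in> tree_edges")
  case False
  then have c: "(x, y) \<in> cycle_edges" using assms by (simp add: tree_edges_def)
  then have r: "x \<in> range v" "y \<in> range v" unfolding cycle_edges_def by auto
  then have "(v (root x), v (root y)) \<in> cycle_edges" using c by auto
  from cycle_edge_cong[OF this] show thesis using that r by blast
qed (use that in blast)

text \<open>Projecting vertices to their roots does not increase distances: a tree edge keeps the
  root vertex and a cycle edge moves it by one position. So leaving the cycle gives no
  shortcut.\<close>

lemma cyc_dist_root_edge:
  assumes "(x, y) \<in> E"
  shows "cyc_dist (root y - i) \<le> cyc_dist (root x - i) + 1"
  using assms
proof (cases rule: edge_cases)
  case 1
  then have "cyc_dist (root y - i) = cyc_dist (root x - i)"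
    by (intro cyc_dist_cong cong_diff cong_refl) (metis root_tree_edge_cong cong_sym)
  then show ?thesis by simp
next
  case 2
  then have "cyc_dist (root y - i) = cyc_dist (root x + 1 - i)"
    by (intro cyc_dist_cong cong_diff cong_refl)
  then show ?thesis using cyc_dist_Suc[of "root x - i"] by (simp add: algebra_simps)
next
  case 3
  then have "cyc_dist (root y - i) = cyc_dist (root x - 1 - i)"
    by (intro cyc_dist_cong cong_diff cong_refl)
  then show ?thesis using cyc_dist_pred[of "root x - i"] by (simp add: algebra_simps)
qed

lemma cyc_dist_le_relpow:
  assumes "(v i, x) \<in> E ^^ k"
  shows "cyc_dist (root x - i) \<le> int k"
  using assms
proof (induction k arbitrary: x)
  case 0
  then have "cyc_dist (root x - i) = cyc_dist (i - i)"
    using root_v_cong by (intro cyc_dist_cong cong_diff cong_refl) auto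
  then show ?case by (simp add: cyc_dist_def)
next
  case (Suc k)
  then obtain y where "(v i, y) \<in> E ^^ k" "(y, x) \<in> E" by auto
  then show ?case using Suc.IH[of y] cyc_dist_root_edge[of y x i] by simp
qed

lemma gdist_v_le: "int (gdist (v i) (v j)) \<le> (j - i) mod n"
proof -
  have "(v i, v (i + int (nat ((j - i) mod n)))) \<in> E ^^ nat ((j - i) mod n)"
    using v_relpow relpowp_mono[to_set, of cycle_edges E] cycle_edges_sub by blast
  then have "(v i, v j) \<in> E ^^ nat ((j - i) mod n)"
    using v_add_mod n_ge_3 by simp
  then have "gdist (v i) (v j) \<le> nat ((j - i) mod n)" by (rule gdist_le)
  then show ?thesis using n_ge_3 by (simp add: le_nat_iff)
qed

text \<open>The two ways round the cycle give the upper bound, the projection to roots the lower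
  one.\<close>

lemma gdist_v: "int (gdist (v i) (v j)) = cyc_dist (j - i)"
proof (rule antisym)
  show "int (gdist (v i) (v j)) \<le> cyc_dist (j - i)"
    using gdist_v_le[of i j] gdist_v_le[of j i] gdist_sym[of "v i"] by (simp add: cyc_dist_def)
  have "cyc_dist (root (v j) - i) \<le> int (gdist (v i) (v j))"
    using gdist_relpow v_in_V cyc_dist_le_relpow by blast
  then show "cyc_dist (j - i) \<le> int (gdist (v i) (v j))"
    using cyc_dist_cong[OF cong_diff[OF root_v_cong cong_refl]] by metis
qed

end

section \<open>Phases modulo 3\<close>

locale cycle3_graph = cycle_graph +
  assumes n_dvd_3: "3 dvd n"
begin

text \<open>
  Only the residue of the phase modulo 3 is meaningful, since \<open>root\<close> is determined modulo \<open>n\<close> only.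
\<close>

definition phase :: "'a \<Rightarrow> int" where
  "phase x = root x + int (depth x)"

lemma cong_mod_3: "[i = j] (mod n) \<Longrightarrow> i mod 3 = j mod 3"
  using n_dvd_3 cong_dvd_modulus unfolding cong_def[symmetric] by blast

lemma phase_v: "phase (v i) mod 3 = i mod 3"
  using cong_mod_3[OF root_v_cong] by (simp add: phase_def)

text \<open>A tree edge keeps the root modulo \<open>n\<close> and changes the depth by 1; a cycle
  edge keeps depth 0 and changes the root by 1.\<close>

lemma phase_edge:
  assumes "(x, y) \<in> E"
  shows "phase x mod 3 \<noteq> phase y mod 3"
  using assms
proof (cases rule: edge_cases)
  case 1
  then have "root x mod 3 = root y mod 3"
    using cong_mod_3 root_tree_edge_cong by blast
  then have "int (depth x) mod 3 = int (depth y) mod 3" if "phase x mod 3 = phase y mod 3"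
    using that mod_3_add_cancel unfolding phase_def by blast
  moreover have "int k mod 3 \<noteq> int (k + 1) mod 3" for k by presburger
  ultimately show ?thesis using tree_edge_depth[OF 1] by metis
next
  case 2
  then have "depth x = 0" "depth y = 0" by auto
  then show ?thesis using cong_mod_3[OF 2(3)] unfolding phase_def by simp presburger
next
  case 3
  then have "depth x = 0" "depth y = 0" by auto
  then show ?thesis using cong_mod_3[OF 3(3)] unfolding phase_def by simp presburger
qed

text \<open>On the cycle, the neighbours \<open>v (i + 1)\<close> and \<open>v (i - 1)\<close> have
  different phases, so \<open>x\<close> or \<open>b\<close> hangs in a tree. Off the cycle, equal
  phases force equal depths, and as the parent is unique, both \<open>x\<close> and \<open>b\<close>
  are children of \<open>a\<close>. The parent and \<open>b\<close> then have further neighbours,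
  and \<open>x\<close> is the third neighbour.\<close>

lemma branching_turn:
  assumes "(a, x) \<in> E" "(a, b) \<in> E" "x \<noteq> b" "(b, y) \<in> E" "y \<noteq> a"
    and "phase x mod 3 = phase b mod 3"
  shows "branching E a"
proof (cases "a \<in> range v")
  case True
  then obtain i where i: "a = v i" by blast
  have "(a, x) \<in> tree_edges \<or> (a, b) \<in> tree_edges"
  proof (rule ccontr)
    assume "\<not> ?thesis"
    then have c: "(v i, x) \<in> cycle_edges" "(v i, b) \<in> cycle_edges"
      using assms(1,2) i by (auto simp: tree_edges_def)
    then have "x = v (i + 1) \<and> b = v (i - 1) \<or> x = v (i - 1) \<and> b = v (i + 1)"
      using cycle_nbr[OF c(1)] cycle_nbr[OF c(2)] assms(3) by auto
    then have "(i + 1) mod 3 = (i - 1) mod 3"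
      using assms(6) phase_v by metis
    then show False by presburger
  qed
  then show ?thesis using branching_attachment i by blast
next
  case False
  have aV: "a \<in> V" using assms(1) edge_verts by blast
  obtain p p' where p: "(a, p) \<in> tree_edges" "depth p < depth a" "(p, p') \<in> E" "p' \<noteq> a"
    using ex_parent[OF aV False] by blast
  have t: "(a, x) \<in> tree_edges" "(a, b) \<in> tree_edges"
    using tree_edgeI False assms(1,2) by blast+
  have "root x mod 3 = root b mod 3"
    using cong_mod_3 root_tree_edge_cong t by metis
  then have eq: "int (depth x) mod 3 = int (depth b) mod 3"
    using assms(6) mod_3_add_cancel unfolding phase_def by blast
  have "depth x = depth b"
    using mod_3_eq_steps[OF eq tree_edge_depth[OF t(1)] tree_edge_depth[OF t(2)]] .
  then have "x \<noteq> p" "b \<noteq> p"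
    using parent_unique[OF t] p(2) assms(3) by auto
  then show ?thesis
    unfolding branching_def using p assms tree_edgeD[OF p(1)] by metis
qed

text \<open>Depths of branching vertices are divisible by 3, so only the roots count. The distance
  of two roots is the difference of their indices modulo \<open>n\<close>, up to sign, and 3 divides
  \<open>n\<close>.\<close>

lemma branching_phase_eq:
  assumes all: "\<And>u w. branching E u \<Longrightarrow> branching E w \<Longrightarrow> 3 dvd gdist u w"
    and u: "branching E u" and w: "branching E w"
  shows "phase u mod 3 = phase w mod 3"
proof -
  have r: "phase u mod 3 = root u mod 3" if "branching E u" for u
  proof -
    have "3 dvd depth u" unfolding depth_def using all that branching_root by blast
    then show ?thesis unfolding phase_def by (auto elim: dvdE)
  qed
  let ?k = "root w - root u"
  have "3 dvd gdist (v (root u)) (v (root w))"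
    using all branching_root u w by blast
  then have "3 dvd cyc_dist ?k"
    using gdist_v[of "root u" "root w"] by (metis int_dvd_int_iff of_nat_numeral)
  then have "3 dvd ?k mod n \<or> 3 dvd (- ?k) mod n"
    unfolding cyc_dist_def by (auto simp: min_def split: if_splits)
  then have "3 dvd ?k"
    using n_dvd_3 by (auto simp: dvd_mod_iff dvd_diff_commute)
  then show ?thesis using r[OF u] r[OF w] by presburger
qed

text \<open>The phases along a geodesic \<open>x\<close>, \<open>a\<close>, \<open>b\<close>,
  \<open>y\<close> form a colouring as in \<open>three_colours_path\<close>; a turn at
  \<open>a\<close> or \<open>b\<close> makes that vertex branching, hence of phase
  \<open>c\<close>.\<close>

lemma phase_E3:
  assumes c: "\<And>u. branching E u \<Longrightarrow> phase u mod 3 = c mod 3"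
    and "(x, y) \<in> E3"
  shows "phase x mod 3 = c mod 3 \<longleftrightarrow> phase y mod 3 = c mod 3"
proof -
  have d: "gdist x y = 3" and V: "x \<in> V" "y \<in> V"
    using assms(2) by (auto simp: E3_def)
  obtain a where a: "(x, a) \<in> E" "gdist a y = 2"
    using gdist_step[OF V] d by force
  then obtain b where b: "(a, b) \<in> E" "gdist b y = 1"
    using gdist_step[of a y] V(2) edge_verts by force
  have y: "(b, y) \<in> E"
    using gdist_relpow[of b y] b V(2) edge_verts(2)[OF b(1)] by simp
  have neq: "x \<noteq> b" "a \<noteq> y" using d a(2) b(2) by auto
  have range: "phase z mod 3 \<in> {0, 1, 2}" for z by auto
  have ta: "phase x mod 3 = phase b mod 3 \<Longrightarrow> phase a mod 3 = c mod 3"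
    using branching_turn[of a x b y] a b y neq c edge_sym by blast
  have tb: "phase y mod 3 = phase a mod 3 \<Longrightarrow> phase b mod 3 = c mod 3"
    using branching_turn[of b y a x] a b y neq c edge_sym by metis
  show ?thesis
    by (rule three_colours_path[OF range range range range
          phase_edge[OF a(1)] phase_edge[OF b(1)] phase_edge[OF y] ta tb])
qed

lemma E3_not_connected:
  assumes "\<And>u w. branching E u \<Longrightarrow> branching E w \<Longrightarrow> 3 dvd gdist u w"
  shows "\<exists>x\<in>V. \<exists>y\<in>V. (x, y) \<notin> E3\<^sup>*"
proof -
  \<comment> \<open>The common phase of the branching vertices; any value will do if there are
    none.\<close>
  obtain c where c: "\<And>u. branching E u \<Longrightarrow> phase u mod 3 = c mod 3"
    using branching_phase_eq[OF assms] by metis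
  have inv: "phase x mod 3 = c mod 3 \<longleftrightarrow> phase y mod 3 = c mod 3" if "(x, y) \<in> E3\<^sup>*" for x y
    using that by induction (use phase_E3[OF c] in blast)+
  have "(v c, v (c + 1)) \<notin> E3\<^sup>*"
  proof
    assume "(v c, v (c + 1)) \<in> E3\<^sup>*"
    from inv[OF this] have "(c + 1) mod 3 = c mod 3" by (simp add: phase_v)
    then show False by presburger
  qed
  then show ?thesis using v_in_V by blast
qed

end

section \<open>Unicyclic graphs\<close>

text \<open>The library notion uses the symmetric closure and reachability inside the vertex set;
  for symmetric arcs between vertices both reduce to the plain closure.\<close>

lemma connected_iff_rtrancl:
  assumes "sym (parcs H)" "parcs H \<subseteq> pverts H \<times> pverts H"
  shows "Digraph_Component.connected (with_proj H) \<longleftrightarrow>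
    pverts H \<noteq> {} \<and> (\<forall>u\<in>pverts H. \<forall>v\<in>pverts H. (u, v) \<in> (parcs H)\<^sup>*)"
proof -
  have "parcs (mk_symmetric (with_proj H)) = parcs H"
    using assms(1) by (auto simp: parcs_mk_symmetric dest: symD)
  moreover have "(u, v) \<in> rtrancl_on (pverts H) (parcs H) \<longleftrightarrow> (u, v) \<in> (parcs H)\<^sup>*"
    if "u \<in> pverts H" for u v
  proof
    assume "(u, v) \<in> (parcs H)\<^sup>*"
    then show "(u, v) \<in> rtrancl_on (pverts H) (parcs H)"
      by induction (use that assms(2) in \<open>auto intro: rtrancl_on_into_rtrancl_on\<close>)
  qed (rule rtrancl_on_rtranclI)
  ultimately show ?thesis
    unfolding Digraph_Component.connected_def strongly_connected_def reachable_def by auto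
qed

section \<open>Translation of walks, degrees and cycles to the arc relation\<close>

context pair_graph
begin

lemma parcs_in_verts: "parcs G \<subseteq> pverts G \<times> pverts G"
  using in_arcsD1 in_arcsD2 by auto

lemma sym_parcs: "sym (parcs G)"
  using arcs_symmetric by (rule symI)

lemma irrefl_parcs: "irrefl (parcs G)"
  using no_loops' by (auto simp: irrefl_def)

lemma awalk_relpow_iff:
  assumes "u \<in> pverts G"
  shows "(\<exists>p. awalk u p w \<and> length p = k) \<longleftrightarrow> (u, w) \<in> parcs G ^^ k"
  using assms
proof (induction k arbitrary: u)
  case 0
  then show ?case by (auto simp: awalk_Nil_iff)
next
  case (Suc k)
  have "(\<exists>p. awalk u p w \<and> length p = Suc k) \<longleftrightarrow>
      (\<exists>e p. awalk u (e # p) w \<and> length p = k)"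
    by (metis length_Suc_conv)
  also have "\<dots> \<longleftrightarrow> (\<exists>x. (u, x) \<in> parcs G \<and> (\<exists>p. awalk x p w \<and> length p = k))"
    by (auto simp: awalk_Cons_iff)
  also have "\<dots> \<longleftrightarrow> (\<exists>x. (u, x) \<in> parcs G \<and> (x, w) \<in> parcs G ^^ k)"
    using Suc.IH in_arcsD2 by blast
  also have "\<dots> \<longleftrightarrow> (u, w) \<in> parcs G ^^ Suc k"
    by (meson relpow_Suc_D2 relpow_Suc_I2)
  finally show ?case .
qed

lemma degree_eq: "degree G u = card {w. (u, w) \<in> parcs G}"
proof -
  have "out_arcs (with_proj G) u = Pair u ` {w. (u, w) \<in> parcs G}"
    by (auto simp: out_arcs_def)
  then show ?thesis by (simp add: out_degree_def card_image inj_on_def)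
qed

lemma finite_nbrs: "finite {w. (u, w) \<in> parcs G \<and> P w}"
  by (rule finite_subset[OF _ pair_finite_verts]) (use in_arcsD2 in auto)

lemma two_le_degree_iff:
  assumes "(u, a) \<in> parcs G"
  shows "2 \<le> degree G a \<longleftrightarrow> (\<exists>a'. (a, a') \<in> parcs G \<and> a' \<noteq> u)"
proof
  let ?N = "{w. (a, w) \<in> parcs G}"
  assume "2 \<le> degree G a"
  then have "\<not> ?N \<subseteq> {u}"
    using card_mono[of "{u}" ?N] by (auto simp: degree_eq)
  then show "\<exists>a'. (a, a') \<in> parcs G \<and> a' \<noteq> u" by blast
next
  let ?N = "{w. (a, w) \<in> parcs G}"
  assume "\<exists>a'. (a, a') \<in> parcs G \<and> a' \<noteq> u"
  then obtain a' where "{u, a'} \<subseteq> ?N" "a' \<noteq> u" using assms arcs_symmetric by blast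
  then show "2 \<le> degree G a"
    using card_mono[of ?N "{u, a'}"] finite_nbrs[of a "\<lambda>_. True"] by (simp add: degree_eq)
qed

lemma inner_node_iff_branching: "inner_node G u \<longleftrightarrow> branching (parcs G) u"
proof
  let ?N = "{w. (u, w) \<in> parcs G}" and ?M = "{w. (u, w) \<in> parcs G \<and> 2 \<le> degree G w}"
  {
    assume "inner_node G u"
    then have N: "3 \<le> card ?N" and M: "2 \<le> card ?M"
      by (auto simp: inner_node_def degree_eq)
    obtain a b where ab: "a \<in> ?M" "b \<in> ?M" "a \<noteq> b"
      using M by (metis (no_types, lifting) card_le_Suc0_iff_eq card.infinite not_less_eq_eq
          numeral_2_eq_2 zero_le)
    have "\<not> ?N \<subseteq> {a, b}"
      using N ab(3) card_mono[of "{a, b}" ?N] by auto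
    then obtain c where "(u, c) \<in> parcs G" "c \<noteq> a" "c \<noteq> b" by blast
    moreover obtain a' b' where "(a, a') \<in> parcs G" "a' \<noteq> u" "(b, b') \<in> parcs G" "b' \<noteq> u"
      using ab two_le_degree_iff by blast
    ultimately show "branching (parcs G) u"
      using branchingI[of a b c u "parcs G" a' b'] ab by auto
  }
  {
    assume "branching (parcs G) u"
    then obtain a b c a' b' where neq: "a \<noteq> b" "a \<noteq> c" "b \<noteq> c"
      and nb: "(u, a) \<in> parcs G" "(u, b) \<in> parcs G" "(u, c) \<in> parcs G"
      and "(a, a') \<in> parcs G" "a' \<noteq> u" "(b, b') \<in> parcs G" "b' \<noteq> u"
      unfolding branching_def by blast
    then have "{a, b} \<subseteq> ?M" using two_le_degree_iff by blast
    then have "2 \<le> card ?M"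
      using card_mono[OF finite_nbrs, of "{a, b}" u "\<lambda>w. 2 \<le> degree G w"] neq by simp
    moreover have "{a, b, c} \<subseteq> ?N" using nb by blast
    then have "3 \<le> card ?N"
      using card_mono[OF finite_nbrs, of "{a, b, c}" u "\<lambda>_. True"] neq by simp
    ultimately show "inner_node G u"
      using nb(1) in_arcsD1 by (auto simp: inner_node_def degree_eq)
  }
qed

lemma awalk_within:
  assumes "(x, y) \<in> R\<^sup>*" "R \<subseteq> parcs G" "x \<in> pverts G"
  shows "\<exists>p. awalk x p y \<and> set p \<subseteq> R"
  using assms(1)
proof (induction rule: rtrancl_induct)
  case base
  then show ?case using assms(3) by (intro exI[of _ "[]"]) (simp add: awalk_Nil_iff)
next
  case (step y z)
  then obtain p where "awalk x p y" "set p \<subseteq> R" by blast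
  moreover have "awalk y [(y, z)] z"
    using step.hyps(2) assms(2) in_arcsD2 by (auto simp: awalk_simps)
  ultimately show ?case
    using step.hyps(2) by (intro exI[of _ "p @ [(y, z)]"]) (auto intro: awalk_appendI)
qed

text \<open>A simple path from \<open>b\<close> back to \<open>a\<close> is closed by the arc
  \<open>(a, b)\<close>. It has at least two arcs, since \<open>a\<close> and \<open>b\<close>
  differ and the arc \<open>(b, a)\<close> was removed.\<close>

lemma cycle_through_edge:
  assumes "(a, b) \<in> parcs G" "(b, a) \<in> (parcs G - {(a, b), (b, a)})\<^sup>*"
  shows "\<exists>C. is_cycle G C \<and> {a, b} \<in> C"
proof -
  let ?R = "parcs G - {(a, b), (b, a)}"
  obtain q where q: "awalk b q a" "set q \<subseteq> ?R"
    using awalk_within[OF assms(2)] in_arcsD2[OF assms(1)] by auto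
  define p where "p = awalk_to_apath q"
  have p: "awalk b p a" "distinct (pawalk_verts b p)" "set p \<subseteq> ?R"
    using apath_awalk_to_apath[OF q(1)] awalk_to_apath_subset[OF q(1)] q(2)
    unfolding p_def apath_def by auto
  have "p \<noteq> []" using p(1) no_loops'[OF assms(1)] by (auto simp: awalk_Nil_iff)
  moreover have "length p \<noteq> 1"
    using p(1,3) by (auto simp: length_Suc_conv awalk_simps)
  ultimately have "3 \<le> length ((a, b) # p)" by (cases p rule: remdups_adj.cases) auto
  moreover have "cycle ((a, b) # p)"
    unfolding cycle_def using p(1,2) assms(1) by (intro exI[of _ a]) (simp add: awalk_Cons_iff)
  ultimately have "is_cycle G ((\<lambda>(u, v). {u, v}) ` set ((a, b) # p))"
    unfolding is_cycle_def by blast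
  then show ?thesis by (intro exI conjI) auto
qed

end

section \<open>The unique cycle and its parametrization\<close>

lemma pcas_nth:
  assumes "pcas u p w" "i < length p"
  shows "fst (p ! i) = (if i = 0 then u else snd (p ! (i - 1)))"
  using assms
proof (induction p arbitrary: u i)
  case (Cons e p)
  then show ?case by (cases i) (auto simp: nth_Cons')
qed simp

lemma pcas_last: "pcas u p w \<Longrightarrow> p \<noteq> [] \<Longrightarrow> snd (last p) = w"
  by (induction p arbitrary: u) auto

lemma pawalk_verts_Cons: "pcas u p w \<Longrightarrow> pawalk_verts u p = u # map snd p"
  by (induction p arbitrary: u) auto

locale unicyclic_girth6 = pair_graph G for G :: "'a pair_pre_digraph" +
  fixes C :: "'a set set"
  assumes unicyclic: "unicyclic G"
    and cycle_C: "is_cycle G C"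
    and girth: "6 \<le> card C"
begin

lemma cycle_unique: "is_cycle G C' \<Longrightarrow> C' = C"
  using unicyclic cycle_C unfolding unicyclic_def by blast

text \<open>By uniqueness the edges of any cycle are those of \<open>C\<close>, and a walk has at
  least as many arcs as edges. This excludes cycles of length 3, 4 and 5 below.\<close>

lemma cycle_length:
  assumes "cycle p" "3 \<le> length p"
  shows "6 \<le> length p"
proof -
  have "C = (\<lambda>(u, v). {u, v}) ` set p"
    using cycle_unique assms unfolding is_cycle_def by blast
  then have "card C \<le> length p"
    using card_image_le[of "set p"] card_length[of p] by (meson List.finite_set le_trans)
  then show ?thesis using girth by simp
qed

lemma parcs_connected: "x \<in> pverts G \<Longrightarrow> y \<in> pverts G \<Longrightarrow> (x, y) \<in> (parcs G)\<^sup>*"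
  using unicyclic connected_iff_rtrancl[OF sym_parcs parcs_in_verts]
  unfolding unicyclic_def by blast

sublocale D: girth6_graph "pverts G" "parcs G"
proof
  show "parcs G \<subseteq> pverts G \<times> pverts G" "sym (parcs G)" "irrefl (parcs G)"
    by (fact parcs_in_verts sym_parcs irrefl_parcs)+
  show "\<And>x y. x \<in> pverts G \<Longrightarrow> y \<in> pverts G \<Longrightarrow> (x, y) \<in> (parcs G)\<^sup>*"
    by (fact parcs_connected)
  show "(c, a) \<notin> parcs G" if "(a, b) \<in> parcs G" "(b, c) \<in> parcs G" for a b c
  proof
    assume "(c, a) \<in> parcs G"
    then have "cycle [(a, b), (b, c), (c, a)]"
      unfolding cycle_def using that no_loops' in_arcsD1
      by (intro exI[of _ a]) (auto simp: awalk_simps)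
    from cycle_length[OF this] show False by simp
  qed
  show "a = c \<or> b = d"
    if "(a, b) \<in> parcs G" "(b, c) \<in> parcs G" "(c, d) \<in> parcs G" "(d, a) \<in> parcs G" for a b c d
  proof (rule ccontr)
    assume "\<not> ?thesis"
    then have "cycle [(a, b), (b, c), (c, d), (d, a)]"
      unfolding cycle_def using that no_loops' in_arcsD1
      by (intro exI[of _ a]) (auto simp: awalk_simps)
    from cycle_length[OF this] show False by simp
  qed
  show "\<not> distinct [a, b, c, d, e]"
    if "(a, b) \<in> parcs G" "(b, c) \<in> parcs G" "(c, d) \<in> parcs G" "(d, e) \<in> parcs G"
      "(e, a) \<in> parcs G" for a b c d e
  proof
    assume "distinct [a, b, c, d, e]"
    then have "cycle [(a, b), (b, c), (c, d), (d, e), (e, a)]"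
      unfolding cycle_def using that in_arcsD1
      by (intro exI[of _ a]) (auto simp: awalk_simps)
    from cycle_length[OF this] show False by simp
  qed
qed

lemma distance_eq_gdist:
  assumes "x \<in> pverts G" "y \<in> pverts G"
  shows "distance G x y = ereal (real (D.gdist x y))"
proof -
  have cost: "awalk_cost (\<lambda>_. 1) p = real (length p)" for p :: "('a \<times> 'a) list"
    by (induction p) simp_all
  obtain p where p: "awalk x p y" "length p = D.gdist x y"
    using awalk_relpow_iff[OF assms(1)] D.gdist_relpow[OF assms] by blast
  show ?thesis
    unfolding distance_def \<mu>_def cost
  proof (rule antisym)
    show "(INF p\<in>{p. awalk x p y}. ereal (real (length p))) \<le> ereal (real (D.gdist x y))"
      using p by (auto intro!: INF_lower2[of p])
    show "ereal (real (D.gdist x y)) \<le> (INF p\<in>{p. awalk x p y}. ereal (real (length p)))"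
    proof (rule INF_greatest)
      fix q assume "q \<in> {q. awalk x q y}"
      then have "(x, y) \<in> parcs G ^^ length q" using awalk_relpow_iff[OF assms(1)] by blast
      then show "ereal (real (D.gdist x y)) \<le> ereal (real (length q))"
        using D.gdist_le by simp
    qed
  qed
qed

lemma parcs_distance_graph: "parcs (distance_graph 3 G) = D.E3"
  by (auto simp: distance_graph_def D.E3_def distance_eq_gdist)

lemma connected_distance_graph_iff:
  "Digraph_Component.connected (with_proj (distance_graph 3 G)) \<longleftrightarrow>
    pverts G \<noteq> {} \<and> (\<forall>x\<in>pverts G. \<forall>y\<in>pverts G. (x, y) \<in> D.E3\<^sup>*)"
proof -
  have "pverts (distance_graph 3 G) = pverts G" by (simp add: distance_graph_def)
  moreover have "sym D.E3" "D.E3 \<subseteq> pverts G \<times> pverts G"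
    using D.E3_sym by (auto intro: symI simp: D.E3_def)
  ultimately show ?thesis
    using connected_iff_rtrancl[of "distance_graph 3 G"] by (simp add: parcs_distance_graph)
qed

lemma cycle_parametrization:
  obtains v where "cycle_graph (pverts G) (parcs G) (int (card C)) v"
proof -
  obtain p where p: "cycle p" "3 \<le> length p" and C: "C = (\<lambda>(u, v). {u, v}) ` set p"
    using cycle_C unfolding is_cycle_def by blast
  then obtain u where u: "awalk u p u" "distinct (tl (pawalk_verts u p))"
    unfolding cycle_def by blast
  have cas: "pcas u p u" using u(1) unfolding awalk_def by simp
  have sub: "set p \<subseteq> parcs G" using u(1) unfolding awalk_def by simp
  have dist: "distinct (map snd p)" using u(2) pawalk_verts_Cons[OF cas] by simp
  have pne: "p \<noteq> []" using p(2) by auto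
  define m where "m = int (length p)"
  have m: "3 \<le> m" using p(2) by (simp add: m_def)
  \<comment> \<open>Position \<open>i\<close> is the head of arc number \<open>i mod m\<close> of
    the closed walk, so arc \<open>i\<close> runs from position \<open>i - 1\<close> to position
    \<open>i\<close>.\<close>
  define v where "v i = snd (p ! nat (i mod m))" for i
  have idx: "nat (i mod m) < length p" for i
  proof -
    have "0 \<le> i mod m" "i mod m < m" using m by simp_all
    then show ?thesis using nat_less_iff m_def by metis
  qed
  have veq: "v i = v j \<longleftrightarrow> [i = j] (mod m)" for i j
  proof -
    have "v i = v j \<longleftrightarrow> nat (i mod m) = nat (j mod m)"
      using nth_eq_iff_index_eq[OF dist, of "nat (i mod m)" "nat (j mod m)"] idx
      by (simp add: v_def)
    also have "\<dots> \<longleftrightarrow> [i = j] (mod m)"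
      using m by (simp add: cong_def eq_nat_nat_iff)
    finally show ?thesis .
  qed
  have edge: "p ! nat ((i + 1) mod m) = (v i, v (i + 1))" for i
  proof -
    have "fst (p ! nat ((i + 1) mod m)) = v i"
    \<comment> \<open>At the wrap-around the first arc starts at \<open>u\<close>, which is the head
      of the last arc because the walk is closed.\<close>
    proof (cases "(i + 1) mod m = 0")
      case True
      then have "m dvd i + 1 - m" by (simp add: mod_eq_0_iff_dvd)
      then have "[i = m - 1] (mod m)" by (simp add: cong_iff_dvd_diff algebra_simps)
      then have "v i = v (m - 1)" using veq by blast
      also have "\<dots> = snd (last p)"
      proof -
        have "(m - 1) mod m = m - 1" using m by (intro mod_pos_pos_trivial) simp_all
        moreover have "nat (m - 1) = length p - 1" by (simp add: m_def)
        ultimately show ?thesis by (simp add: v_def last_conv_nth[OF pne])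
      qed
      also have "\<dots> = u" using pcas_last[OF cas pne] .
      finally show ?thesis using pcas_nth[OF cas idx, of "i + 1"] True by simp
    next
      case False
      have "(i + 1) mod m = i mod m + 1"
      proof -
        have eq: "(i + 1) mod m = (i mod m + 1) mod m" by (simp add: mod_simps)
        have "0 \<le> i mod m" "i mod m < m" using m by simp_all
        moreover have "i mod m + 1 \<noteq> m" using False unfolding eq by auto
        ultimately show ?thesis unfolding eq by simp
      qed
      moreover have "0 \<le> i mod m" using m by simp
      ultimately have "nat ((i + 1) mod m) = Suc (nat (i mod m))" by (simp add: nat_add_distrib)
      then show ?thesis using pcas_nth[OF cas idx, of "i + 1"] by (simp add: v_def)
    qed
    then show ?thesis by (simp add: v_def prod_eq_iff)
  qed
  have edgeE: "\<exists>i. e = (v i, v (i + 1))" if e: "e \<in> set p" for e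
  proof -
    obtain k where k: "k < length p" "e = p ! k" using e by (auto simp: in_set_conv_nth)
    then have "nat ((int k - 1 + 1) mod m) = k" by (simp add: m_def)
    then show ?thesis using edge[of "int k - 1"] k by metis
  qed
  \<comment> \<open>Two arcs with the same edge would be opposite to each other, which forces
    \<open>m dvd 2\<close>. Hence the number of edges in \<open>C\<close> is the length of the
    walk.\<close>
  have "inj_on (\<lambda>(u, v). {u, v}) (set p)"
  proof (rule inj_onI, rule ccontr)
    fix e f
    assume ef: "e \<in> set p" "f \<in> set p"
      "(case e of (u, v) \<Rightarrow> {u, v}) = (case f of (u, v) \<Rightarrow> {u, v})"
      and "e \<noteq> f"
    obtain i j where ij: "e = (v i, v (i + 1))" "f = (v j, v (j + 1))"
      using edgeE[OF ef(1)] edgeE[OF ef(2)] by metis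
    have "{v i, v (i + 1)} = {v j, v (j + 1)}" using ef(3) unfolding ij by simp
    then have "v i = v (j + 1)" "v (i + 1) = v j"
      using \<open>e \<noteq> f\<close> unfolding ij doubleton_eq_iff by blast+
    then have "m dvd (i - (j + 1)) - (i + 1 - j)"
      unfolding veq cong_iff_dvd_diff by (rule dvd_diff)
    then have "m dvd 2" by simp
    then show False using m zdvd_imp_le by fastforce
  qed
  then have "card C = card (set p)" unfolding C by (rule card_image)
  also have "\<dots> = length p" using dist by (simp add: distinct_card distinct_map)
  finally have n: "int (card C) = m" by (simp add: m_def)
  have "cycle_graph (pverts G) (parcs G) m v"
  proof
    show "3 \<le> m" by fact
    show "\<And>i j. v i = v j \<longleftrightarrow> [i = j] (mod m)" by fact
    show "\<And>i. (v i, v (i + 1)) \<in> parcs G"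
      using nth_mem[OF idx] sub unfolding edge[symmetric] by blast
    show "\<exists>i. {a, b} = {v i, v (i + 1)}"
      if ab: "(a, b) \<in> parcs G" "(b, a) \<in> (parcs G - {(a, b), (b, a)})\<^sup>*" for a b
    proof -
      have "{a, b} \<in> C" using cycle_through_edge[OF ab] cycle_unique by blast
      from this[unfolded C] obtain e where e: "{a, b} = (case e of (u, v) \<Rightarrow> {u, v})" "e \<in> set p"
        by (rule imageE)
      from edgeE[OF e(2)] obtain i where "e = (v i, v (i + 1))" by (rule exE)
      then show ?thesis using e(1) by auto
    qed
  qed
  then show thesis using that n by metis
qed

end

theorem theorem2p9:
  fixes G :: "'a pair_pre_digraph" and C :: "'a set set" and n :: nat
  assumes "pair_graph G"
    and "unicyclic G"
    and "is_cycle G C"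
    and "card C = n"
    and "n \<ge> 6"
    and "gcd n 3 = 3"
  shows "Digraph_Component.connected (with_proj (distance_graph 3 G)) \<longleftrightarrow>
    (\<exists>u v. inner_node G u \<and> inner_node G v \<and>
      (\<exists>k::nat. distance G u v = ereal (real (3 * k + 1)) \<or>
                distance G u v = ereal (real (3 * k + 2))))"
    (is "?L \<longleftrightarrow> ?R")
proof -
  interpret unicyclic_girth6 G C
  proof (rule unicyclic_girth6.intro)
    show "pair_graph G" by fact
    show "unicyclic_girth6_axioms G C"
      using assms(2-5) by (intro unicyclic_girth6_axioms.intro) simp_all
  qed
  obtain v where v: "cycle_graph (pverts G) (parcs G) (int n) v"
    using cycle_parametrization assms(4) by blast
  have "3 dvd n" using assms(6) by (metis gcd_dvd1)
  then have "3 dvd int n" by presburger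
  then interpret K: cycle3_graph "pverts G" "parcs G" "int n" v
    by (rule cycle3_graph.intro[OF v cycle3_graph_axioms.intro])
  have V: "u \<in> pverts G" if "branching (parcs G) u" for u
    using that in_arcsD1 unfolding branching_def by blast
  have not_dvd: "\<not> 3 dvd d \<longleftrightarrow> (\<exists>k. d = 3 * k + 1 \<or> d = 3 * k + 2)" for d :: nat
    by presburger
  have "(\<exists>k::nat. distance G u w = ereal (real (3 * k + 1)) \<or>
      distance G u w = ereal (real (3 * k + 2))) \<longleftrightarrow> \<not> 3 dvd D.gdist u w"
    if "branching (parcs G) u" "branching (parcs G) w" for u w
    unfolding distance_eq_gdist[OF V[OF that(1)] V[OF that(2)]] not_dvd
    by (simp only: ereal.inject of_nat_eq_iff)
  then have "?R \<longleftrightarrow>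
      (\<exists>u w. branching (parcs G) u \<and> branching (parcs G) w \<and> \<not> 3 dvd D.gdist u w)"
    unfolding inner_node_iff_branching by blast
  also have "\<dots> \<longleftrightarrow> ?L"
    \<comment> \<open>A pair of branching vertices also shows that the vertex set is nonempty, as
      connectedness demands.\<close>
    unfolding connected_distance_graph_iff
    using D.E3_connected K.E3_not_connected V by blast
  finally show ?thesis by blast
qed

end
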